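(* Let $k\ge1$ and let $q$ be a prime power with $q\equiv -1\pmod 4$ and $q>(2^{2k+1})^2$. Then the Paley tournament $PT_q$ has no transitive $k$-coloring.
   Context: The Paley tournament $PT_q$ has vertex set $GF(q)$, and $xy$ is an edge iff $y-x$ is a nonzero square in $GF(q)$. A transitive $k$-coloring of a tournament is an edge coloring with colors $1,\dots,k$ such that for each color $i$ the digraph of edges of color $i$ is transitive (whenever $ab,bc$ have color $i$, $ac$ is an edge of color $i$). *)

theory Defs
  imports "HOL-Number_Theory.Number_Theory" "HOL-Library.Cardinality"
begin

definition paley_tournament :: "'a::field rel" where
  "paley_tournament = {(x, y). y - x \<noteq> 0 \<and> (\<exists>z. y - x = z\<^sup>2)}"

definition transitive_coloring :: "nat \<Rightarrow> 'a rel \<Rightarrow> ('a \<times> 'a \<Rightarrow> nat) \<Rightarrow> bool" where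
  "transitive_coloring k E c \<longleftrightarrow>
     c ` E \<subseteq> {1..k} \<and> (\<forall>i\<in>{1..k}. trans {e \<in> E. c e = i})"

end

theory Submission
  imports Defs
begin

text \<open>
  In a transitive coloring, all edges from the color-\<open>i\<close> in-neighborhood of a vertex \<open>v\<close> to its
  color-\<open>i\<close> out-neighborhood are present. By the character sum bound, a Paley tournament with
  \<open>q\<close> vertices contains no complete \<open>A \<times> B\<close> with \<open>|A| |B| \<ge> q\<close>, so one of these two neighborhoods
  has fewer than \<open>\<surd>q\<close> vertices. Classify the vertices by the set of colors whose out-neighborhood
  is large; some class \<open>T\<close> has at least \<open>q / 2\<^sup>k\<close> vertices. Within \<open>T\<close>, each color contributes
  fewer than \<open>|T| \<surd>q\<close> edges, counting each edge at its head or at its tail according to the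
  class, and \<open>k |T| \<surd>q\<close> edges are too few for a tournament on \<open>T\<close>.
\<close>

section \<open>Nonzero squares in a finite field\<close>

text \<open>Every orbit \<open>{x, f x}\<close> has two elements; the induction removes one orbit at
  a time.\<close>

lemma even_card_fixpoint_free_involution:
  assumes "finite A" "\<And>x. x \<in> A \<Longrightarrow> f x \<in> A" "\<And>x. x \<in> A \<Longrightarrow> f (f x) = x"
    "\<And>x. x \<in> A \<Longrightarrow> f x \<noteq> x"
  shows "even (card A)"
  using assms
proof (induction A rule: finite_psubset_induct)
  case (psubset A)
  show ?case
  proof (cases "A = {}")
    case False
    then obtain x where x: "x \<in> A" by blast
    let ?B = "A - {x, f x}"
    have "even (card ?B)"
    proof (rule psubset.IH)
      show "?B \<subset> A" using x by blast
      fix y assume y: "y \<in> ?B"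
      then have "f y \<noteq> x" "f y \<noteq> f x"
        using psubset.prems(2)[of y] psubset.prems(2)[OF x] by auto
      then show "f y \<in> ?B" using y psubset.prems(1) by blast
    qed (use psubset.prems in auto)
    moreover have "card ?B = card A - 2" "card A \<ge> 2"
      using card_Diff_subset[of "{x, f x}" A] card_mono[OF psubset.hyps, of "{x, f x}"]
        x psubset.prems(1,3)[OF x] by auto
    ultimately show ?thesis by simp
  qed simp
qed

definition nonzero_squares :: "'a::field set" where
  "nonzero_squares = {x. x \<noteq> 0 \<and> (\<exists>z. x = z\<^sup>2)}"

lemma paley_tournament_iff: "(x, y) \<in> paley_tournament \<longleftrightarrow> y - x \<in> nonzero_squares"
  by (simp add: paley_tournament_def nonzero_squares_def)

lemma nonzero_squares_mult:
  "x \<in> nonzero_squares \<Longrightarrow> y \<in> nonzero_squares \<Longrightarrow> x * y \<in> nonzero_squares"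
  by (auto simp: nonzero_squares_def simp flip: power_mult_distrib)

lemma nonzero_squares_inverse:
  "x \<in> nonzero_squares \<Longrightarrow> inverse x \<in> nonzero_squares"
  by (auto simp: nonzero_squares_def simp flip: power_inverse)

text \<open>If \<open>-z = z\<close>, translation by \<open>z\<close> would be a fixpoint-free
  involution of the field.\<close>

lemma uminus_neq_self_odd_card:
  assumes "odd (CARD('a::{field, finite}))" and "(z::'a) \<noteq> 0"
  shows "-z \<noteq> z"
proof
  assume "-z = z"
  then have "(x + z) + z = x" for x :: 'a
    by (metis add.assoc add.right_inverse add_0_right)
  then have "even (card (UNIV::'a set))"
    using assms(2) by (intro even_card_fixpoint_free_involution[where f = "\<lambda>x. x + z"]) auto
  with assms(1) show False by simp
qed

text \<open>Squaring maps the nonzero elements two-to-one onto the nonzero squares, with fibres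
  \<open>{z, -z}\<close>.\<close>

lemma card_nonzero_squares:
  assumes "odd (CARD('a::{field, finite}))"
  shows "CARD('a) = 2 * card (nonzero_squares :: 'a set) + 1"
proof -
  let ?Q = "nonzero_squares :: 'a set"
  have fibre: "card {z \<in> -{0}. z\<^sup>2 = s} = 2" if "s \<in> ?Q" for s :: 'a
  proof -
    from that obtain z where z: "s = z\<^sup>2" "z \<noteq> 0" by (auto simp: nonzero_squares_def)
    then have "{z \<in> -{0}. z\<^sup>2 = s} = {z, -z}" by (auto simp: power2_eq_iff)
    moreover have "-z \<noteq> z" using uminus_neq_self_odd_card[OF assms] z by blast
    ultimately show ?thesis by simp
  qed
  have "card (-{0::'a}) = (\<Sum>s\<in>?Q. card {z \<in> -{0}. z\<^sup>2 = s})"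
    using sum.group[of "-{0::'a}" ?Q "\<lambda>z. z\<^sup>2" "\<lambda>_. 1::nat"]
    by (force simp: nonzero_squares_def)
  then have "card (-{0::'a}) = 2 * card ?Q" using fibre by simp
  moreover have "card (-{0::'a}) = CARD('a) - 1" by (simp add: Compl_eq_Diff_UNIV card_Diff_singleton)
  moreover have "CARD('a) \<ge> 1" by (simp add: Suc_leI)
  ultimately show ?thesis by linarith
qed

text \<open>The number (q - 1) / 2 of nonzero squares is odd, so negation cannot pair them up and -1
  is not a square. The nonzero squares and their negatives are then disjoint, and by their number
  they fill all nonzero elements.\<close>

lemma uminus_nonzero_squares_iff:
  assumes "CARD('a::{field, finite}) mod 4 = 3" and "(x::'a) \<noteq> 0"
  shows "-x \<in> nonzero_squares \<longleftrightarrow> x \<notin> nonzero_squares"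
proof -
  let ?Q = "nonzero_squares :: 'a set"
  have odd: "odd (CARD('a))" using assms(1) by presburger
  note card = card_nonzero_squares[OF odd]
  have oddQ: "odd (card ?Q)" using card assms(1) by presburger
  have "-1 \<notin> ?Q"
  proof
    assume m: "-1 \<in> ?Q"
    have "even (card ?Q)"
    proof (rule even_card_fixpoint_free_involution[where f = uminus])
      fix z :: 'a assume z: "z \<in> ?Q"
      show "-z \<in> ?Q" using nonzero_squares_mult[OF m z] by simp
      show "-z \<noteq> z"
        by (rule uminus_neq_self_odd_card[OF odd]) (use z in \<open>simp add: nonzero_squares_def\<close>)
    qed auto
    with oddQ show False by simp
  qed
  \<comment> \<open>If both were nonzero squares, so would be their quotient
    \<open>-z * inverse z\<close>, which is -1.\<close>
  then have disj: "\<not> (z \<in> ?Q \<and> -z \<in> ?Q)" for z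
    using nonzero_squares_mult[of "-z" "inverse z"] nonzero_squares_inverse[of z]
    by (auto simp: nonzero_squares_def)
  have "card (?Q \<union> uminus ` ?Q) = 2 * card ?Q"
    using disj by (subst card_Un_disjoint) (auto simp: card_image)
  moreover have "card (-{0::'a}) = 2 * card ?Q" using card by (simp add: Compl_eq_Diff_UNIV card_Diff_singleton)
  moreover have "?Q \<union> uminus ` ?Q \<subseteq> -{0}" by (auto simp: nonzero_squares_def)
  ultimately have "?Q \<union> uminus ` ?Q = -{0}" by (intro card_subset_eq) auto
  then have "x \<in> ?Q \<or> -x \<in> ?Q" using assms(2) by fastforce
  with disj show ?thesis by blast
qed

section \<open>The quadratic character and the biclique bound\<close>

text \<open>The Legendre symbol when the field has odd prime order. The value 0 at 0 lets
  multiplicativity and oddness hold on the whole field.\<close>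

definition quadratic_char :: "'a::field \<Rightarrow> int" where
  "quadratic_char x = (if x = 0 then 0 else if x \<in> nonzero_squares then 1 else -1)"

lemma quadratic_char_1: "quadratic_char 1 = 1"
  unfolding quadratic_char_def nonzero_squares_def by (auto intro: exI[of _ 1])

context
  assumes card_mod_4: "CARD('a::{field, finite}) mod 4 = 3"
begin

lemma quadratic_char_uminus: "quadratic_char (-x) = - quadratic_char (x::'a)"
  using uminus_nonzero_squares_iff[OF card_mod_4, of x] by (auto simp: quadratic_char_def)

text \<open>Multiplication by a nonzero square preserves being a nonzero square, which settles the
  case of a nonzero square \<open>x\<close>. If \<open>-x\<close> is one instead, oddness of the
  character reduces to that case.\<close>

lemma quadratic_char_mult:
  "quadratic_char (x * y) = quadratic_char x * quadratic_char (y::'a)"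
proof -
  have pos: "quadratic_char (x * y) = quadratic_char x * quadratic_char y"
    if "x \<in> nonzero_squares" for x y :: 'a
  proof -
    have "y \<in> nonzero_squares" if "x * y \<in> nonzero_squares"
      using nonzero_squares_mult[OF nonzero_squares_inverse[OF \<open>x \<in> nonzero_squares\<close>] that]
        \<open>x \<in> nonzero_squares\<close> by (simp add: nonzero_squares_def field_simps)
    then show ?thesis
      using that nonzero_squares_mult[OF that, of y]
      by (auto simp: quadratic_char_def nonzero_squares_def)
  qed
  consider "x = 0" | "x \<in> nonzero_squares" | "-x \<in> nonzero_squares"
    using uminus_nonzero_squares_iff[OF card_mod_4, of x] by blast
  then show ?thesis
  proof cases
    case 3
    with pos[of "-x" y] show ?thesis by (simp add: quadratic_char_uminus)
  qed (simp_all add: pos, simp add: quadratic_char_def)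
qed

text \<open>The character is odd, so substituting \<open>-x\<close> for \<open>x\<close> negates the
  sum.\<close>

lemma sum_quadratic_char: "(\<Sum>x\<in>UNIV. quadratic_char (x::'a)) = 0"
proof -
  have "(\<Sum>x\<in>UNIV. quadratic_char (x::'a)) = (\<Sum>x\<in>UNIV. quadratic_char (-x::'a))"
    by (rule sum.reindex_bij_witness[of _ uminus uminus]) auto
  then show ?thesis by (simp add: quadratic_char_uminus sum_negf)
qed

text \<open>After a shift, y (y - c) = y^2 (1 - c/y) with c = b - a, so each term is the character
  of 1 - c/y. If c is nonzero, this argument runs over all elements except 1, and the full character
  sum vanishes.\<close>

lemma quadratic_char_correlation:
  "(\<Sum>x\<in>UNIV. quadratic_char (x - a) * quadratic_char (x - b)) =
    (if a = (b::'a) then int (CARD('a)) - 1 else -1)"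
proof -
  let ?c = "b - a"
  have "(\<Sum>x\<in>UNIV. quadratic_char (x - a) * quadratic_char (x - b)) =
      (\<Sum>y\<in>UNIV. quadratic_char y * quadratic_char (y - ?c))"
    by (rule sum.reindex_bij_witness[of _ "\<lambda>y. y + a" "\<lambda>x. x - a"]) (auto simp: algebra_simps)
  also have "\<dots> = (\<Sum>y\<in>-{0}. quadratic_char y * quadratic_char (y - ?c))"
    by (rule sum.mono_neutral_right) (auto simp: quadratic_char_def)
  also have "\<dots> = (\<Sum>y\<in>-{0}. quadratic_char (1 - ?c / y))"
  proof (rule sum.cong)
    fix y :: 'a assume y: "y \<in> -{0}"
    then have "y * (y - ?c) = (y * y) * (1 - ?c / y)" by (simp add: field_simps)
    moreover have "quadratic_char (y * y) = 1"
      using y by (auto simp: quadratic_char_def nonzero_squares_def simp flip: power2_eq_square)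
    ultimately show "quadratic_char y * quadratic_char (y - ?c) = quadratic_char (1 - ?c / y)"
      by (metis mult_1 quadratic_char_mult)
  qed simp
  also have "\<dots> = (if a = b then int (CARD('a)) - 1 else -1)"
  proof (cases "a = b")
    case True
    then show ?thesis
      by (simp add: quadratic_char_1 Compl_eq_Diff_UNIV card_Diff_singleton of_nat_diff Suc_leI)
  next
    case False
    have "(\<Sum>y\<in>-{0}. quadratic_char (1 - ?c / y)) = (\<Sum>z\<in>-{1}. quadratic_char (z::'a))"
      by (rule sum.reindex_bij_witness[of _ "\<lambda>z. ?c / (1 - z)" "\<lambda>y. 1 - ?c / y"])
        (use False in \<open>auto simp: field_simps\<close>)
    also have "\<dots> = (\<Sum>z\<in>UNIV. quadratic_char (z::'a)) - quadratic_char (1::'a)"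
      by (simp add: Compl_eq_Diff_UNIV sum_diff1)
    finally show ?thesis using False by (simp add: sum_quadratic_char quadratic_char_1)
  qed
  finally show ?thesis .
qed

text \<open>A second-moment argument: \<open>?f\<close> equals |A| at every point of
  \<open>B\<close>, while by the correlations its squares sum to |A| (q - |A|) over the field.
  Dividing by |A| leaves |A| |B| \<le> q - |A|.\<close>

lemma paley_tournament_complete_bipartite:
  assumes "A \<times> B \<subseteq> (paley_tournament :: 'a rel)"
  shows "card A * card B < CARD('a)"
proof (cases "A = {}")
  case False
  let ?q = "int (CARD('a))" and ?f = "\<lambda>x. \<Sum>a\<in>A. quadratic_char (x - a)"
  have f: "?f b = int (card A)" if "b \<in> B" for b
  proof -
    have "quadratic_char (b - a) = 1" if "a \<in> A" for a
      using assms that \<open>b \<in> B\<close> paley_tournament_iff[of a b]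
      by (auto simp: quadratic_char_def nonzero_squares_def)
    then show ?thesis by simp
  qed
  have "int (card B) * (int (card A))\<^sup>2 = (\<Sum>b\<in>B. (?f b)\<^sup>2)" using f by simp
  also have "\<dots> \<le> (\<Sum>x\<in>UNIV. (?f x)\<^sup>2)" by (rule sum_mono2) auto
  also have "\<dots> = (\<Sum>x\<in>UNIV. \<Sum>a\<in>A. \<Sum>b\<in>A. quadratic_char (x - a) * quadratic_char (x - b))"
    by (simp add: power2_eq_square sum_product)
  also have "\<dots> = (\<Sum>a\<in>A. \<Sum>b\<in>A. \<Sum>x\<in>UNIV. quadratic_char (x - a) * quadratic_char (x - b))"
    by (subst sum.swap) (intro sum.cong refl sum.swap)
  also have "\<dots> = (\<Sum>a\<in>A. \<Sum>b\<in>A. (if a = b then ?q else 0) - 1)"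
    unfolding quadratic_char_correlation by (intro sum.cong) auto
  also have "\<dots> = int (card A) * (?q - int (card A))"
    by (simp add: sum_subtractf)
  finally have "int (card A) * (int (card A) * int (card B)) \<le> int (card A) * (?q - int (card A))"
    by (simp add: power2_eq_square algebra_simps)
  moreover have "int (card A) > 0" using False by (simp add: card_gt_0_iff)
  ultimately have "int (card A) * int (card B) < ?q"
    by (smt (verit) mult_le_cancel_left_pos)
  then show ?thesis by (simp flip: of_nat_mult)
qed simp

end

section \<open>Edge counting in a transitive coloring\<close>

lemma no_transitive_coloring_of_no_large_bicliques:
  fixes E :: "'a::finite rel"
  assumes total: "total E"
    and biclique: "\<And>A B. A \<times> B \<subseteq> E \<Longrightarrow> card A * card B < CARD('a)"
    and large: "CARD('a) > (2 ^ (2 * k + 1))\<^sup>2"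
  shows "\<not> transitive_coloring k E c"
proof
  assume col: "transitive_coloring k E c"
  define D where "D i = {e \<in> E. c e = i}" for i
  \<comment> \<open>Two neighborhoods with at least \<open>r\<close> vertices each would span a
    biclique that violates the bound.\<close>
  define r where "r = sqrt (real (CARD('a)))"
  define large_out where "large_out v = {i \<in> {1..k}. real (card (D i `` {v})) \<ge> r}" for v
  have in_small: "real (card ((D i)\<inverse> `` {v})) < r" if "i \<in> large_out v" for i v
  proof (rule ccontr)
    assume "\<not> ?thesis"
    moreover have "real (card (D i `` {v})) \<ge> r" using that by (simp add: large_out_def)
    ultimately have "r * r \<le> real (card ((D i)\<inverse> `` {v})) * real (card (D i `` {v}))"
      by (intro mult_mono) (auto simp: r_def)
    moreover have "trans (D i)"
      using col that by (auto simp: transitive_coloring_def D_def large_out_def)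
    then have "(D i)\<inverse> `` {v} \<times> D i `` {v} \<subseteq> D i" by (auto dest: transD)
    then have "(D i)\<inverse> `` {v} \<times> D i `` {v} \<subseteq> E" by (auto simp: D_def)
    from biclique[OF this]
    have "real (card ((D i)\<inverse> `` {v})) * real (card (D i `` {v})) < r * r"
      by (simp add: r_def flip: of_nat_mult)
    ultimately show False by linarith
  qed

  \<comment> \<open>Pigeonhole over the 2^k subsets of \<open>{1..k}\<close>; \<open>r * r\<close>
    is the number of vertices.\<close>
  obtain S where S: "real (card {v. large_out v = S}) * 2 ^ k \<ge> r * r"
  proof -
    have "\<exists>S. card {v. large_out v = S} * 2 ^ k \<ge> CARD('a)"
    proof (rule ccontr)
      assume "\<not> ?thesis"
      then have "(\<Sum>S\<in>Pow {1..k}. card {v. large_out v = S} * 2 ^ k) <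
          (\<Sum>S\<in>Pow {1..k}. CARD('a))"
        by (intro sum_strict_mono) (auto simp: not_le)
      moreover have "range large_out \<subseteq> Pow {1..k}" by (auto simp: large_out_def)
      then have "(\<Sum>S\<in>Pow {1..k}. card {v. large_out v = S}) = CARD('a)"
        using sum.group[of "UNIV::'a set" "Pow {1..k}" large_out "\<lambda>_. 1::nat"] by simp
      ultimately show False by (simp add: card_Pow flip: sum_distrib_right)
    qed
    then obtain S where "card {v. large_out v = S} * 2 ^ k \<ge> CARD('a)" ..
    then have "real (CARD('a)) \<le> real (card {v. large_out v = S} * 2 ^ k)"
      by (simp only: of_nat_le_iff)
    then show ?thesis by (intro that) (simp add: r_def)
  qed
  define T where "T = {v. large_out v = S}"

  \<comment> \<open>\<open>F i\<close> collects the edges of color \<open>i\<close> with head in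
    \<open>T\<close> if \<open>i \<in> S\<close>, and with tail in \<open>T\<close> otherwise. The
    other end may lie outside \<open>T\<close>, so the bounds on full neighborhoods apply.\<close>
  define F where "F i = (if i \<in> S then (\<Union>v\<in>T. (D i)\<inverse> `` {v} \<times> {v})
    else (\<Union>v\<in>T. {v} \<times> D i `` {v}))" for i
  have F: "real (card (F i)) \<le> card T * r" if "i \<in> {1..k}" for i
  proof (cases "i \<in> S")
    case True
    have "card (F i) \<le> (\<Sum>v\<in>T. card ((D i)\<inverse> `` {v} \<times> {v}))"
      unfolding F_def using True by (simp only: if_True) (rule card_UN_le, simp)
    then have "real (card (F i)) \<le> (\<Sum>v\<in>T. real (card ((D i)\<inverse> `` {v})))"
      by (simp add: card_cartesian_product flip: of_nat_sum)
    also have "\<dots> \<le> (\<Sum>v\<in>T. r)"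
      using in_small True by (intro sum_mono less_imp_le) (auto simp: T_def)
    finally show ?thesis by simp
  next
    case False
    have "card (F i) \<le> (\<Sum>v\<in>T. card ({v} \<times> D i `` {v}))"
      unfolding F_def using False by (simp only: if_False) (rule card_UN_le, simp)
    then have "real (card (F i)) \<le> (\<Sum>v\<in>T. real (card (D i `` {v})))"
      by (simp add: card_cartesian_product flip: of_nat_sum)
    also have "\<dots> \<le> (\<Sum>v\<in>T. r)"
      using False that by (intro sum_mono less_imp_le) (auto simp: T_def large_out_def)
    finally show ?thesis by simp
  qed

  have "E \<inter> T \<times> T \<subseteq> (\<Union>i\<in>{1..k}. F i)"
  proof
    fix e assume e: "e \<in> E \<inter> T \<times> T"
    then have "c e \<in> {1..k}" using col by (auto simp: transitive_coloring_def)
    moreover have "e \<in> F (c e)" using e by (auto simp: F_def D_def)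
    ultimately show "e \<in> (\<Union>i\<in>{1..k}. F i)" by blast
  qed
  then have "card (E \<inter> T \<times> T) \<le> card (\<Union>i\<in>{1..k}. F i)" by (intro card_mono) auto
  also have "\<dots> \<le> (\<Sum>i\<in>{1..k}. card (F i))" by (rule card_UN_le) simp
  finally have "real (card (E \<inter> T \<times> T)) \<le> (\<Sum>i\<in>{1..k}. real (card (F i)))"
    by (simp flip: of_nat_sum)
  also have "\<dots> \<le> (\<Sum>i\<in>{1..k}. card T * r)" by (intro sum_mono F)
  finally have few: "real (card (E \<inter> T \<times> T)) \<le> k * card T * r" by simp

  have totalD: "(y, x) \<in> E" if "x \<noteq> y" "(x, y) \<notin> E" for x y
    using total that by (simp add: total_on_def) metis
  \<comment> \<open>A pair in \<open>T\<close> is an edge, a reversed edge or diagonal, so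
    \<open>E\<close> has at least |T| (|T| - 1) / 2 edges inside \<open>T\<close>.\<close>
  have "T \<times> T \<subseteq> (E \<inter> T \<times> T) \<union> (E \<inter> T \<times> T)\<inverse> \<union> Id_on T"
    using totalD by (auto simp: Id_on_iff)
  then have "card (T \<times> T) \<le> card ((E \<inter> T \<times> T) \<union> (E \<inter> T \<times> T)\<inverse> \<union> Id_on T)"
    by (intro card_mono) auto
  also have "\<dots> \<le> card (E \<inter> T \<times> T) + card ((E \<inter> T \<times> T)\<inverse>) + card (Id_on T)"
    by (meson card_Un_le add_le_mono1 le_trans)
  also have "card ((E \<inter> T \<times> T)\<inverse>) = card (E \<inter> T \<times> T)" by (rule card_inverse)
  also have "card (Id_on T) = card T"
    by (simp add: Id_on_def card_UN_disjoint)
  finally have "card T * card T \<le> 2 * card (E \<inter> T \<times> T) + card T"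
    by (simp add: card_cartesian_product)
  then have "real (card T * card T) \<le> real (2 * card (E \<inter> T \<times> T) + card T)"
    by (simp only: of_nat_le_iff)
  with few have "real (card T) * card T \<le> card T * (2 * k * r + 1)"
    by (simp add: algebra_simps)
  moreover have r: "r > 2 ^ (2 * k + 1)"
  proof -
    have "real ((2 ^ (2 * k + 1))\<^sup>2) < real (CARD('a))" using large by (simp only: of_nat_less_iff)
    then show ?thesis unfolding r_def by (intro real_less_rsqrt) simp
  qed
  \<comment> \<open>This allows one factor |T| to be cancelled from the quadratic
    inequality.\<close>
  moreover have "card T > 0"
  proof (rule ccontr)
    assume "\<not> ?thesis"
    then have "r * r \<le> 0" using S by (simp add: T_def)
    moreover have "r > 0" using r by (smt (verit) zero_less_power)
    ultimately show False by (simp add: mult_le_0_iff)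
  qed
  ultimately have upper: "real (card T) \<le> 2 * k * r + 1" by simp

  have "(1::real) \<le> 2 ^ (2 * k)" by simp
  then have r2: "r > 2" using r unfolding power_add power_one_right by linarith
  \<comment> \<open>The exponent 2k + 1 is spent here: one factor 2^k pays for passing to the class
    \<open>T\<close>, and 2^(k+1) remains.\<close>
  have "(2 * 2 ^ k * r) * 2 ^ k = 2 ^ (2 * k + 1) * r"
    by (simp add: power_even_eq power2_eq_square)
  also have "\<dots> < r * r" using r r2 by simp
  also have "\<dots> \<le> real (card T) * 2 ^ k" using S by (simp add: T_def)
  finally have "2 * 2 ^ k * r < card T" by (simp add: mult_ac)
  \<comment> \<open>Hence |T| > 2 (k + 1) r, which exceeds the upper bound 2 k r + 1 because 2 r >
    1.\<close>
  moreover have "(real k + 1) * r \<le> 2 ^ k * r"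
  proof -
    have "k + 1 \<le> 2 ^ k" by (simp add: Suc_le_eq)
    then have "real (k + 1) \<le> real (2 ^ k)" by (simp only: of_nat_le_iff)
    then show ?thesis using r2 by (intro mult_right_mono) auto
  qed
  ultimately show False using upper r2 by (simp add: algebra_simps)
qed

theorem theorem3p5:
  fixes k q :: nat
  assumes "k \<ge> 1"
    and "primepow q"
    and "CARD('a::{field, finite}) = q"
    and "[int q = - 1] (mod 4)"
    and "q > (2 ^ (2 * k + 1))\<^sup>2"
  shows "\<not> (\<exists>c. transitive_coloring k (paley_tournament :: 'a rel) c)"
proof -
  have "int q mod 4 = 3" using assms(4) by (simp add: cong_def)
  then have mod: "CARD('a) mod 4 = 3" unfolding assms(3) by presburger
  \<comment> \<open>As -1 is not a square, one of \<open>x - y\<close> and \<open>y - x\<close> is a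
    nonzero square.\<close>
  have "total (paley_tournament :: 'a rel)"
  proof (rule total_onI)
    fix x y :: 'a assume "x \<noteq> y"
    then show "(x, y) \<in> paley_tournament \<or> (y, x) \<in> paley_tournament"
      using uminus_nonzero_squares_iff[OF mod, of "x - y"] by (auto simp: paley_tournament_iff)
  qed
  then show ?thesis
    using no_transitive_coloring_of_no_large_bicliques[of paley_tournament k]
      paley_tournament_complete_bipartite[OF mod] assms(3,5) by blast
qed

end
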